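(* Let $G$ be a finite group, and let $h\in\mathrm{Sym}(G)$. Then $$\pi_{\mathrm{K}}(L_h)=\begin{cases}(0,0), & \text{if }G\text{ satisfies the Hall-Paige condition},\\ \left(\tfrac12|G|,\tfrac12|G|\right), & \text{otherwise}.\end{cases}$$
   Context: A finite group satisfies the Hall-Paige condition if its Sylow $2$-subgroups are trivial or noncyclic. A Latin square over $X=\{x_1,\ldots,x_n\}$ ($|X|=n$, with this fixed ordering) is a matrix $L=(\ell_{i,j})_{1\leq i,j\leq n}$ with entries in $X$ such that each element of $X$ occurs exactly once in each row and in each column. Its $i$-th row permutation is the permutation $P_i\in\mathrm{Sym}(X)$ with $P_i(x_j)=\ell_{i,j}$ for all $j$; its $j$-th column permutation is $Q_j\in\mathrm{Sym}(X)$ with $Q_j(x_i)=\ell_{i,j}$ for all $i$. The Kotlar parity type $\pi_{\mathrm{K}}(L)$ is the unique pair $(k,m)\in\{0,1,\ldots,\lfloor n/2\rfloor\}^2$ such that exactly $k$ of the $n$ row permutations have one common parity (the other $n-k$ having the opposite parity), and exactly $m$ of the $n$ column permutations have one common parity (the other $n-m$ having the opposite parity). That is, $k$ (respectively $m$) is the minimum of the number of even and the number of odd row (respectively column) permutations. For a finite group $G=\{g_1,\ldots,g_n\}$ of order $n$ and $h\in\mathrm{Sym}(G)$, $L_h=L_h(G)$ is the Latin square $(h(g_i)g_j)_{1\leq i,j\leq n}$ over $G$. *)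

theory Defs
  imports
    "HOL-Algebra.Elementary_Groups"
    "HOL-Combinatorics.Permutations"
    "HOL-Computational_Algebra.Primes"
begin

section \<open>The Hall-Paige condition\<close>

definition sylow_subgroup :: "('a, 'b) monoid_scheme \<Rightarrow> nat \<Rightarrow> 'a set \<Rightarrow> bool" where
  "sylow_subgroup G p P \<longleftrightarrow> subgroup P G \<and> card P = p ^ multiplicity p (order G)"

definition hall_paige :: "('a, 'b) monoid_scheme \<Rightarrow> bool" where
  "hall_paige G \<longleftrightarrow>
     (\<forall>P. sylow_subgroup G 2 P \<longrightarrow>
        trivial_group (G\<lparr>carrier := P\<rparr>) \<or> \<not> cyclic_group (G\<lparr>carrier := P\<rparr>))"


section \<open>Latin squares and their parity types\<close>

text \<open>
  Rows and columns are indexed by \<open>{1..card X}\<close>; only the values \<open>L i j\<close> with both indices in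
  that range are entries of the square. An ordering \<open>x\<^sub>1, \<dots>, x\<^sub>n\<close> of \<open>X\<close> is a function \<open>x\<close> with
  \<open>bij_betw x {1..card X} X\<close>.
\<close>

definition latin_square :: "'a set \<Rightarrow> (nat \<Rightarrow> nat \<Rightarrow> 'a) \<Rightarrow> bool" where
  "latin_square X L \<longleftrightarrow>
     finite X \<and>
     (\<forall>i\<in>{1..card X}. \<forall>j\<in>{1..card X}. L i j \<in> X) \<and>
     (\<forall>a\<in>X. \<forall>i\<in>{1..card X}. \<exists>!j. j \<in> {1..card X} \<and> L i j = a) \<and>
     (\<forall>a\<in>X. \<forall>j\<in>{1..card X}. \<exists>!i. i \<in> {1..card X} \<and> L i j = a)"

definition row_perm :: "'a set \<Rightarrow> (nat \<Rightarrow> 'a) \<Rightarrow> (nat \<Rightarrow> nat \<Rightarrow> 'a) \<Rightarrow> nat \<Rightarrow> 'a \<Rightarrow> 'a" where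
  "row_perm X x L i = (\<lambda>y. if y \<in> X then L i (inv_into {1..card X} x y) else y)"

definition column_perm :: "'a set \<Rightarrow> (nat \<Rightarrow> 'a) \<Rightarrow> (nat \<Rightarrow> nat \<Rightarrow> 'a) \<Rightarrow> nat \<Rightarrow> 'a \<Rightarrow> 'a" where
  "column_perm X x L j = (\<lambda>y. if y \<in> X then L (inv_into {1..card X} x y) j else y)"

lemma row_perm_apply:
  assumes "bij_betw x {1..card X} X" "j \<in> {1..card X}"
  shows "row_perm X x L i (x j) = L i j"
  using assms by (auto simp: row_perm_def bij_betw_def)

lemma column_perm_apply:
  assumes "bij_betw x {1..card X} X" "i \<in> {1..card X}"
  shows "column_perm X x L j (x i) = L i j"
  using assms by (auto simp: column_perm_def bij_betw_def)

lemma row_perm_permutes: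
  assumes L: "latin_square X L" and x: "bij_betw x {1..card X} X" and i: "i \<in> {1..card X}"
  shows "row_perm X x L i permutes X"
proof -
  have "bij_betw (L i) {1..card X} X"
  proof (rule bij_betw_imageI)
    show "inj_on (L i) {1..card X}"
      using L i unfolding latin_square_def inj_on_def by metis
    have "a \<in> L i ` {1..card X}" if "a \<in> X" for a
      using L i that unfolding latin_square_def by (metis imageI)
    moreover have "L i ` {1..card X} \<subseteq> X"
      using L i unfolding latin_square_def by (metis image_subsetI)
    ultimately show "L i ` {1..card X} = X" by blast
  qed
  then have "bij_betw (L i \<circ> inv_into {1..card X} x) X X"
    using bij_betw_inv_into[OF x] bij_betw_trans by blast
  then have "bij_betw (row_perm X x L i) X X"
    by (rule bij_betw_cong[THEN iffD1, rotated]) (simp add: row_perm_def)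
  then show ?thesis
    by (rule bij_imp_permutes) (simp add: row_perm_def)
qed

lemma column_perm_permutes:
  assumes L: "latin_square X L" and x: "bij_betw x {1..card X} X" and j: "j \<in> {1..card X}"
  shows "column_perm X x L j permutes X"
proof -
  have "bij_betw (\<lambda>i. L i j) {1..card X} X"
  proof (rule bij_betw_imageI)
    show "inj_on (\<lambda>i. L i j) {1..card X}"
      using L j unfolding latin_square_def inj_on_def by metis
    have "a \<in> (\<lambda>i. L i j) ` {1..card X}" if "a \<in> X" for a
      using L j that unfolding latin_square_def by (metis (no_types, lifting) image_eqI)
    moreover have "(\<lambda>i. L i j) ` {1..card X} \<subseteq> X"
      using L j unfolding latin_square_def by (metis (no_types, lifting) image_subsetI)
    ultimately show "(\<lambda>i. L i j) ` {1..card X} = X" by blast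
  qed
  then have "bij_betw ((\<lambda>i. L i j) \<circ> inv_into {1..card X} x) X X"
    using bij_betw_inv_into[OF x] bij_betw_trans by blast
  then have "bij_betw (column_perm X x L j) X X"
    by (rule bij_betw_cong[THEN iffD1, rotated]) (simp add: column_perm_def)
  then show ?thesis
    by (rule bij_imp_permutes) (simp add: column_perm_def)
qed

definition kotlar_parity_type ::
    "'a set \<Rightarrow> (nat \<Rightarrow> 'a) \<Rightarrow> (nat \<Rightarrow> nat \<Rightarrow> 'a) \<Rightarrow> nat \<times> nat" where
  "kotlar_parity_type X x L =
     (min (card {i \<in> {1..card X}. evenperm (row_perm X x L i)})
          (card {i \<in> {1..card X}. \<not> evenperm (row_perm X x L i)}),
      min (card {j \<in> {1..card X}. evenperm (column_perm X x L j)})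
          (card {j \<in> {1..card X}. \<not> evenperm (column_perm X x L j)}))"

lemma min_card_parity_iff:
  fixes n k :: nat and Q :: "nat \<Rightarrow> bool"
  shows "k = min (card {i \<in> {1..n}. Q i}) (card {i \<in> {1..n}. \<not> Q i}) \<longleftrightarrow>
    k \<le> n div 2 \<and> (\<exists>b. card {i \<in> {1..n}. Q i = b} = k \<and> card {i \<in> {1..n}. Q i \<noteq> b} = n - k)"
proof -
  have "card {i \<in> {1..n}. Q i} + card {i \<in> {1..n}. \<not> Q i} =
      card ({i \<in> {1..n}. Q i} \<union> {i \<in> {1..n}. \<not> Q i})"
    by (rule card_Un_disjoint[symmetric]) auto
  also have "{i \<in> {1..n}. Q i} \<union> {i \<in> {1..n}. \<not> Q i} = {1..n}"
    by auto
  finally have "card {i \<in> {1..n}. Q i} + card {i \<in> {1..n}. \<not> Q i} = n"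
    by simp
  then show ?thesis
    by (auto simp: ex_bool_eq min_def)
qed

text \<open>
  The parity type is the unique pair \<open>(k, m)\<close> with \<open>k, m \<le> \<lfloor>n/2\<rfloor>\<close> such that \<open>k\<close> of the row
  permutations share a parity, the other \<open>n - k\<close> having the opposite one, and likewise for \<open>m\<close>
  and the column permutations.
\<close>

lemma kotlar_parity_type_eq_iff:
  "kotlar_parity_type X x L = (k, m) \<longleftrightarrow>
     k \<in> {0..card X div 2} \<and> m \<in> {0..card X div 2} \<and>
     (\<exists>b. card {i \<in> {1..card X}. evenperm (row_perm X x L i) = b} = k \<and>
          card {i \<in> {1..card X}. evenperm (row_perm X x L i) \<noteq> b} = card X - k) \<and>
     (\<exists>b. card {j \<in> {1..card X}. evenperm (column_perm X x L j) = b} = m \<and>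
          card {j \<in> {1..card X}. evenperm (column_perm X x L j) \<noteq> b} = card X - m)"
proof -
  have "kotlar_parity_type X x L = (k, m) \<longleftrightarrow>
      k = min (card {i \<in> {1..card X}. evenperm (row_perm X x L i)})
              (card {i \<in> {1..card X}. \<not> evenperm (row_perm X x L i)}) \<and>
      m = min (card {j \<in> {1..card X}. evenperm (column_perm X x L j)})
              (card {j \<in> {1..card X}. \<not> evenperm (column_perm X x L j)})"
    unfolding kotlar_parity_type_def by auto
  then show ?thesis
    unfolding min_card_parity_iff by auto
qed


section \<open>The Latin square of a permutation of a group\<close>

definition group_latin_square ::
    "('a, 'b) monoid_scheme \<Rightarrow> (nat \<Rightarrow> 'a) \<Rightarrow> ('a \<Rightarrow> 'a) \<Rightarrow> nat \<Rightarrow> nat \<Rightarrow> 'a" where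
  "group_latin_square G g h i j = h (g i) \<otimes>\<^bsub>G\<^esub> g j"

lemma latin_square_group_latin_square:
  assumes "group G" and fin: "finite (carrier G)"
    and g: "bij_betw g {1..order G} (carrier G)" and h: "h permutes carrier G"
  shows "latin_square (carrier G) (group_latin_square G g h)"
proof -
  interpret group G by fact
  have gc: "g i \<in> carrier G" if "i \<in> {1..order G}" for i
    using g that by (auto simp: bij_betw_def)
  have hc: "h y \<in> carrier G" if "y \<in> carrier G" for y
    using permutes_in_image[OF h] that by simp
  have hg: "bij_betw (\<lambda>i. h (g i)) {1..order G} (carrier G)"
    using bij_betw_trans[OF g permutes_imp_bij[OF h]] by (simp add: comp_def)
  have ex: "\<exists>!i. i \<in> {1..order G} \<and> f i = b"
    if f: "bij_betw f {1..order G} (carrier G)" and b: "b \<in> carrier G" for f b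
  proof (rule ex_ex1I)
    have "b \<in> f ` {1..order G}"
      using b by (simp only: bij_betw_imp_surj_on[OF f])
    then show "\<exists>i. i \<in> {1..order G} \<and> f i = b"
      by blast
  next
    fix i j
    assume "i \<in> {1..order G} \<and> f i = b" "j \<in> {1..order G} \<and> f j = b"
    then show "i = j"
      by (intro inj_onD[OF bij_betw_imp_inj_on[OF f]]) simp_all
  qed
  have row: "\<exists>!j. j \<in> {1..order G} \<and> h (g i) \<otimes>\<^bsub>G\<^esub> g j = a"
    if a: "a \<in> carrier G" and i: "i \<in> {1..order G}" for a i
  proof -
    have *: "h (g i) \<otimes>\<^bsub>G\<^esub> g j = a \<longleftrightarrow> g j = inv\<^bsub>G\<^esub> (h (g i)) \<otimes>\<^bsub>G\<^esub> a"
      if "j \<in> {1..order G}" for j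
      using inv_solve_left[OF gc[OF that] hc[OF gc[OF i]] a] by auto
    have "inv\<^bsub>G\<^esub> (h (g i)) \<otimes>\<^bsub>G\<^esub> a \<in> carrier G"
      using a hc[OF gc[OF i]] by simp
    from ex[OF g this] show ?thesis
      by (simp add: * cong: conj_cong)
  qed
  have col: "\<exists>!i. i \<in> {1..order G} \<and> h (g i) \<otimes>\<^bsub>G\<^esub> g j = a"
    if a: "a \<in> carrier G" and j: "j \<in> {1..order G}" for a j
  proof -
    have *: "h (g i) \<otimes>\<^bsub>G\<^esub> g j = a \<longleftrightarrow> h (g i) = a \<otimes>\<^bsub>G\<^esub> inv\<^bsub>G\<^esub> (g j)"
      if "i \<in> {1..order G}" for i
      using inv_solve_right[OF hc[OF gc[OF that]] a gc[OF j]] by auto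
    have "a \<otimes>\<^bsub>G\<^esub> inv\<^bsub>G\<^esub> (g j) \<in> carrier G"
      using a gc[OF j] by simp
    from ex[OF hg this] show ?thesis
      by (simp add: * cong: conj_cong)
  qed
  show ?thesis
    unfolding latin_square_def group_latin_square_def order_def[symmetric]
    using fin row col by (intro conjI ballI) (simp_all add: gc hc)
qed

text \<open>Where the Hall-Paige condition fails, \<open>order G div 2\<close> is exactly half the group order.\<close>

lemma not_hall_paige_imp_even_order:
  assumes "group G" "finite (carrier G)" "\<not> hall_paige G"
  shows "even (order G)"
proof (rule ccontr)
  assume odd: "odd (order G)"
  interpret group G by fact
  obtain P where P: "subgroup P G" "card P = 2 ^ multiplicity 2 (order G)"
      "\<not> trivial_group (G\<lparr>carrier := P\<rparr>)"
    using assms(3) unfolding hall_paige_def sylow_subgroup_def by blast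
  have "card P = 1"
    using P(2) odd by (simp add: not_dvd_imp_multiplicity_0)
  then have "P = {\<one>\<^bsub>G\<^esub>}"
    using subgroup.one_closed[OF P(1)] by (metis card_1_singletonE singletonD)
  then have "trivial_group (G\<lparr>carrier := P\<rparr>)"
    using subgroup.subgroup_is_group[OF P(1)] assms(1) by (simp add: trivial_group_def)
  then show False using P(3) by contradiction
qed

end

theory Submission
  imports Defs "HOL-Algebra.Multiplicative_Group" "HOL-Combinatorics.Cycles"
begin

text \<open>
  The \<open>i\<close>-th row permutation of \<open>L\<^sub>h\<close> is the left translation by \<open>h(g\<^sub>i)\<close>, and the \<open>j\<close>-th column
  permutation is \<open>h\<close> followed by the right translation by \<open>g\<^sub>j\<close>. Right translation by \<open>a\<close> is
  conjugate, under inversion, to left translation by \<open>a\<^sup>-\<^sup>1\<close>, so it has the same sign as left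
  translation by \<open>a\<close>. Hence both coordinates of the parity type only depend on the homomorphism
  \<open>\<chi>\<close> that takes \<open>a\<close> to the sign of its left translation: when \<open>a\<close> runs over \<open>G\<close>, the rows
  have the signs \<open>\<chi>(a)\<close> and the columns the signs \<open>\<chi>(a) sgn(h)\<close>, and the constant factor
  \<open>sgn(h)\<close> is invisible to the minimum of the two counts. If \<open>\<chi>\<close> is trivial, the minimum is \<open>0\<close>.
  Otherwise \<open>\<chi>\<close> takes both values equally often, and the minimum is half the order
  (\<open>min_card_parity_translations\<close>).

  It remains to see that \<open>\<chi>\<close> is nontrivial exactly when the Hall-Paige condition fails
  (\<open>ex_odd_translation_iff_not_hall_paige\<close>). All cycles of the translation by \<open>a\<close> have length
  \<open>ord a\<close>, and there are \<open>|G| / ord a\<close> of them. The translation is therefore odd iff \<open>ord a\<close> is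
  even and \<open>|G| / ord a\<close> is odd, that is, iff \<open>ord a\<close> is even and contains the full power of \<open>2\<close>
  in \<open>|G|\<close>. A suitable power of such an \<open>a\<close> generates a nontrivial cyclic Sylow 2-subgroup, and
  conversely a generator of such a subgroup is such an \<open>a\<close>.
\<close>

section \<open>Permutations whose cycles all have the same length\<close>

lemma evenperm_cycle_of_list:
  assumes "cycle cs" "cs \<noteq> []"
  shows "evenperm (cycle_of_list cs) \<longleftrightarrow> odd (length cs)"
  using assms
proof (induction cs rule: cycle_of_list.induct)
  case (1 i j cs)
  have "evenperm (cycle_of_list (i # j # cs)) \<longleftrightarrow>
      evenperm (transpose i j) = evenperm (cycle_of_list (j # cs))"
    unfolding cycle_of_list.simps
    by (intro evenperm_comp permutation_swap_id permutation_of_cycle)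
  with 1 show ?case
    by (auto simp: evenperm_swap simp del: cycle_of_list.simps)
qed simp_all

lemma cycle_of_list_funpow_fixes_iff:
  assumes "cycle cs" "x \<in> set cs"
  shows "(cycle_of_list cs ^^ i) x = x \<longleftrightarrow> length cs dvd i"
proof -
  obtain j where j: "j < length cs" "x = cs ! j"
    using assms(2) by (auto simp: in_set_conv_nth)
  have "(cycle_of_list cs ^^ i) x = map (cycle_of_list cs ^^ i) cs ! j"
    using j by simp
  also have "\<dots> = cs ! ((i + j) mod length cs)"
    using j by (simp add: cyclic_rotation[OF assms(1)] nth_rotate)
  finally have "(cycle_of_list cs ^^ i) x = x \<longleftrightarrow> (i + j) mod length cs = j"
    using j assms(1) nth_eq_iff_index_eq[of cs "(i + j) mod length cs" j]
      mod_less_divisor[of "length cs" "i + j"] by (cases cs) simp_all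
  also have "\<dots> \<longleftrightarrow> length cs dvd i"
    using j mod_eq_dvd_iff_nat[of j "i + j" "length cs"] by simp
  finally show ?thesis .
qed

lemma cycle_decomp_imp_permutes:
  assumes "cycle_decomp S p"
  shows "p permutes S"
  using assms
proof induction
  case (comp I p cs)
  then show ?case
    by (intro permutes_compose permutes_subset[OF cycle_permutes] permutes_subset[OF comp.IH]) auto
qed (rule permutes_id)

text \<open>
  The hypothesis on the powers of \<open>p\<close> says, without mentioning cycles, that each point lies on a cycle of
  length \<open>m\<close>. So \<open>p\<close> is a product of \<open>card S div m\<close> cycles of length \<open>m\<close>, each of which is odd
  iff \<open>m\<close> is even.
\<close>

lemma evenperm_of_equal_cycle_lengths:
  assumes "p permutes S" "finite S" "m > 0"
    and "\<And>x i. x \<in> S \<Longrightarrow> (p ^^ i) x = x \<longleftrightarrow> m dvd i"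
  shows "evenperm p \<longleftrightarrow> odd m \<or> even (card S div m)"
proof -
  have "cycle_decomp S p"
    by (rule cycle_decomposition) fact+
  then have "finite S \<and> (evenperm p \<longleftrightarrow> odd m \<or> even (card S div m))"
    using assms(4)
  proof induction
    case empty
    show ?case using evenperm_id by (auto simp: id_def)
  next
    case (comp I p cs)
    let ?c = "cycle_of_list cs"
    \<comment> \<open>The cycle and \<open>p\<close> have disjoint supports, so powers of the product restrict to powers of
      each factor; the hypothesis passes to \<open>p\<close> on \<open>I\<close> and forces the cycle to have length \<open>m\<close>.\<close>
    have p: "p permutes I"
      using comp.hyps(1) by (rule cycle_decomp_imp_permutes)
    have on_I: "((?c \<circ> p) ^^ i) x = (p ^^ i) x \<and> (p ^^ i) x \<in> I" if "x \<in> I" for x i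
    proof (induction i)
      case (Suc i)
      then have "p ((p ^^ i) x) \<in> I"
        using permutes_in_image[OF p] by simp
      then show ?case
        using Suc comp.hyps(3) by (auto intro: id_outside_supp)
    qed (use that in simp)
    have on_cs: "((?c \<circ> p) ^^ i) x = (?c ^^ i) x \<and> (?c ^^ i) x \<in> set cs" if "x \<in> set cs" for x i
    proof (induction i)
      case (Suc i)
      then have "(?c ^^ i) x \<notin> I"
        using comp.hyps(3) by auto
      then show ?case
        using Suc permutes_not_in[OF p] permutes_in_image[OF cycle_permutes[of cs]] by simp
    qed (use that in simp)
    have IH: "finite I \<and> (evenperm p \<longleftrightarrow> odd m \<or> even (card I div m))"
      by (rule comp.IH) (use comp.prems on_I in \<open>metis UnCI\<close>)
    show ?case
    \<comment> \<open>A cycle decomposition may contain the empty list, whose cycle is the identity.\<close>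
    proof (cases "cs = []")
      case True
      then show ?thesis using IH by simp
    next
      case False
      then have "m dvd i \<longleftrightarrow> length cs dvd i" for i
        using comp.prems[of "hd cs" i] on_cs[of "hd cs" i]
          cycle_of_list_funpow_fixes_iff[OF comp.hyps(2), of "hd cs" i]
        by (simp del: o_apply)
      then have m: "m = length cs"
        by (meson dvd_antisym dvd_refl)
      have "card (set cs \<union> I) = m + card I"
        using IH comp.hyps m by (simp add: card_Un_disjoint distinct_card)
      moreover have "evenperm (?c \<circ> p) \<longleftrightarrow> evenperm ?c = evenperm p"
        using IH p by (intro evenperm_comp permutation_of_cycle permutes_imp_permutation) auto
      ultimately show ?thesis
        using IH m \<open>m > 0\<close> evenperm_cycle_of_list[OF comp.hyps(2) False]
        by (auto simp del: o_apply)
    qed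
  qed
  then show ?thesis ..
qed


section \<open>The sign of a translation\<close>

context group
begin

lemma bij_betw_mult_left: "a \<in> carrier G \<Longrightarrow> bij_betw (\<lambda>x. a \<otimes> x) (carrier G) (carrier G)"
  by (simp add: bij_betw_def inj_on_multc inj_on_cmult surj_const_mult)

text \<open>
  By cancellation, \<open>a\<^sup>i x = x\<close> iff \<open>a\<^sup>i = \<one>\<close>, for every \<open>x\<close>: all cycles of the translation have
  length \<open>ord a\<close>.
\<close>

lemma sign_on_mult_left_eq_minus_one_iff:
  assumes "finite (carrier G)" "a \<in> carrier G"
  shows "sign_on (carrier G) (\<lambda>x. a \<otimes> x) = -1 \<longleftrightarrow> even (ord a) \<and> odd (order G div ord a)"
proof -
  let ?p = "restrict_id (\<lambda>x. a \<otimes> x) (carrier G)"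
  have funpow: "(?p ^^ i) x = a [^] i \<otimes> x" if "x \<in> carrier G" for x i
  proof (induction i)
    case (Suc i)
    then show ?case
      using that assms(2) by (simp add: m_assoc[symmetric] nat_pow_comm flip: nat_pow_Suc2)
  qed (use that in simp)
  have "evenperm ?p \<longleftrightarrow> odd (ord a) \<or> even (card (carrier G) div ord a)"
  proof (rule evenperm_of_equal_cycle_lengths)
    show "?p permutes carrier G"
      by (rule permutes_restrict_id[OF bij_betw_mult_left[OF assms(2)]])
    show "0 < ord a"
      using ord_ge_1[OF assms] by simp
    show "(?p ^^ i) x = x \<longleftrightarrow> ord a dvd i" if "x \<in> carrier G" for x i
      using that assms(2) by (simp add: funpow pow_eq_id[symmetric])
  qed fact
  then show ?thesis
    by (simp add: sign_on_def sign_def order_def)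
qed

lemma sign_on_mult_left_mult:
  assumes "finite (carrier G)" "a \<in> carrier G" "b \<in> carrier G"
  shows "sign_on (carrier G) (\<lambda>x. (a \<otimes> b) \<otimes> x) =
    sign_on (carrier G) (\<lambda>x. a \<otimes> x) * sign_on (carrier G) (\<lambda>x. b \<otimes> x)"
proof -
  have "sign_on (carrier G) (\<lambda>x. (a \<otimes> b) \<otimes> x) =
      sign_on (carrier G) ((\<lambda>x. a \<otimes> x) \<circ> (\<lambda>x. b \<otimes> x))"
    using assms by (intro sign_on_cong) (simp_all add: m_assoc)
  also have "\<dots> = sign_on (carrier G) (\<lambda>x. a \<otimes> x) * sign_on (carrier G) (\<lambda>x. b \<otimes> x)"
    using assms by (intro sign_on_compose bij_betw_mult_left)
  finally show ?thesis .
qed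

text \<open>
  Since \<open>x a = (a\<^sup>-\<^sup>1 x\<^sup>-\<^sup>1)\<^sup>-\<^sup>1\<close>, right translation by \<open>a\<close> is the conjugate of left translation
  by \<open>a\<^sup>-\<^sup>1\<close> under inversion; and \<open>a\<^sup>-\<^sup>1\<close> has the same order as \<open>a\<close>.
\<close>

lemma sign_on_mult_right:
  assumes fin: "finite (carrier G)" and a: "a \<in> carrier G"
  shows "sign_on (carrier G) (\<lambda>x. x \<otimes> a) = sign_on (carrier G) (\<lambda>x. a \<otimes> x)"
proof -
  let ?s = "sign_on (carrier G)" and ?i = "\<lambda>x. inv x"
  have i: "bij_betw ?i (carrier G) (carrier G)"
    by (rule bij_betw_byWitness[where f' = ?i]) auto
  have l: "bij_betw (\<lambda>x. inv a \<otimes> x) (carrier G) (carrier G)"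
    using a by (simp add: bij_betw_mult_left)
  have "?s (\<lambda>x. x \<otimes> a) = ?s (?i \<circ> ((\<lambda>x. inv a \<otimes> x) \<circ> ?i))"
    using a by (intro sign_on_cong) (simp_all add: inv_mult_group)
  also have "\<dots> = ?s ?i * (?s (\<lambda>x. inv a \<otimes> x) * ?s ?i)"
    using i l fin by (simp add: sign_on_compose[OF i bij_betw_trans[OF i l]] sign_on_compose[OF l i]
        del: o_apply)
  also have "\<dots> = ?s (\<lambda>x. inv a \<otimes> x)"
    by (simp add: sign_on_def)
  also have "\<dots> = ?s (\<lambda>x. a \<otimes> x)"
  proof -
    have "?s (\<lambda>x. inv a \<otimes> x) = -1 \<longleftrightarrow> ?s (\<lambda>x. a \<otimes> x) = -1"
      using fin a by (simp add: sign_on_mult_left_eq_minus_one_iff)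
    then show ?thesis
      by (auto simp: sign_on_def sign_def split: if_splits)
  qed
  finally show ?thesis .
qed


section \<open>Odd translations and cyclic Sylow 2-subgroups\<close>

lemma cyclic_group_subgroup_iff:
  assumes "subgroup P G"
  shows "cyclic_group (G\<lparr>carrier := P\<rparr>) \<longleftrightarrow> (\<exists>a\<in>P. P = generate G {a})"
proof -
  have "generate (G\<lparr>carrier := P\<rparr>) (P \<inter> {a}) = generate G {a}" if "a \<in> P" for a
    using that assms generate_consistent[of "{a}" P] by simp
  then show ?thesis
    by (auto simp: cyclic_group_def subgroup_generated_def)
       (metis partial_object.surjective partial_object.select_convs(1) partial_object.update_convs(1))+
qed

text \<open>
  The translation by \<open>a\<close> is odd iff \<open>ord a\<close> is even and has the same 2-part \<open>2\<^sup>k\<close> as \<open>order G\<close>.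
  Then \<open>b = a\<^sup>r\<close> with \<open>r = ord a / 2\<^sup>k\<close> has order \<open>2\<^sup>k\<close> and generates a cyclic Sylow 2-subgroup.
  Conversely, a generator of a nontrivial cyclic Sylow 2-subgroup has order \<open>2\<^sup>k\<close> with \<open>k > 0\<close>.
\<close>

lemma ex_odd_translation_iff_not_hall_paige:
  assumes fin: "finite (carrier G)"
  shows "(\<exists>a\<in>carrier G. sign_on (carrier G) (\<lambda>x. a \<otimes> x) = -1) \<longleftrightarrow> \<not> hall_paige G"
proof
  assume "\<exists>a\<in>carrier G. sign_on (carrier G) (\<lambda>x. a \<otimes> x) = -1"
  then obtain a where a: "a \<in> carrier G" and ev: "even (ord a)" and od: "odd (order G div ord a)"
    using sign_on_mult_left_eq_minus_one_iff[OF fin] by auto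
  have ord_pos: "ord a \<noteq> 0"
    using ord_ge_1[OF fin a] by simp
  define k where "k = multiplicity 2 (ord a)"
  have k: "2 ^ k dvd ord a"
    unfolding k_def by (rule multiplicity_dvd)
  have "k > 0"
    using ev ord_pos by (simp add: k_def multiplicity_gt_zero_iff)
  have "order G = ord a * (order G div ord a)"
    using ord_dvd_group_order[OF a] by simp
  moreover have "order G div ord a \<noteq> 0"
    using od by (metis even_zero)
  ultimately have mult: "multiplicity 2 (order G) = k"
    using ord_pos od prime_elem_multiplicity_mult_distrib[of 2 "ord a" "order G div ord a"]
    by (simp add: k_def not_dvd_imp_multiplicity_0)
  define b where "b = a [^] (ord a div 2 ^ k)"
  have b: "b \<in> carrier G"
    using a by (simp add: b_def)
  have "ord b = ord a div (ord a div 2 ^ k)"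
    unfolding b_def
    using k ord_pos by (intro ord_pow a) (auto elim!: dvdE)
  then have ord_b: "ord b = 2 ^ k"
    using k ord_pos by (auto elim!: dvdE)
  let ?P = "generate G {b}"
  have P: "subgroup ?P G"
    using b by (intro generate_is_subgroup) simp
  have card_P: "card ?P = 2 ^ k"
    using generate_pow_card[OF b] ord_b by simp
  have "sylow_subgroup G 2 ?P"
    using P card_P mult by (simp add: sylow_subgroup_def)
  moreover have "\<not> trivial_group (G\<lparr>carrier := ?P\<rparr>)"
  proof
    assume "trivial_group (G\<lparr>carrier := ?P\<rparr>)"
    then have "card ?P = 1"
      by (simp add: trivial_group_def)
    then show False
      using card_P \<open>k > 0\<close> by simp
  qed
  moreover have "cyclic_group (G\<lparr>carrier := ?P\<rparr>)"
    unfolding cyclic_group_subgroup_iff[OF P] using generate.incl[of b "{b}" G] by blast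
  ultimately show "\<not> hall_paige G"
    unfolding hall_paige_def by blast
next
  assume "\<not> hall_paige G"
  then obtain P where P: "subgroup P G" "card P = 2 ^ multiplicity 2 (order G)"
      and nontriv: "\<not> trivial_group (G\<lparr>carrier := P\<rparr>)" and cyc: "cyclic_group (G\<lparr>carrier := P\<rparr>)"
    unfolding hall_paige_def sylow_subgroup_def by blast
  obtain a where "a \<in> P" and Pa: "P = generate G {a}"
    using cyc unfolding cyclic_group_subgroup_iff[OF P(1)] by blast
  then have a: "a \<in> carrier G"
    using subgroup.mem_carrier[OF P(1)] by blast
  have ord_a: "ord a = 2 ^ multiplicity 2 (order G)"
    using generate_pow_card[OF a] P(2) Pa by simp
  have "even (ord a)"
  proof (rule ccontr)
    assume "odd (ord a)"
    then have "ord a = 1"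
      unfolding ord_a by simp
    then have "a = \<one>"
      using ord_eq_1[OF a] by blast
    then have "P = {\<one>}"
      using Pa generate_one by simp
    then show False
      using nontriv subgroup.subgroup_is_group[OF P(1) is_group] by (simp add: trivial_group_def)
  qed
  moreover have "order G \<noteq> 0"
    using fin order_gt_0_iff_finite by simp
  then have "odd (order G div ord a)"
    unfolding ord_a using multiplicity_decompose[of "order G" 2] by simp
  ultimately show "\<exists>a\<in>carrier G. sign_on (carrier G) (\<lambda>x. a \<otimes> x) = -1"
    using a sign_on_mult_left_eq_minus_one_iff[OF fin] by blast
qed


section \<open>Counting translations of either sign\<close>

text \<open>
  Multiplication by an element \<open>c\<close> with odd translation exchanges the elements with even and those
  with odd translations.
\<close>

lemma card_translations_of_sign:
  assumes fin: "finite (carrier G)" and "\<not> hall_paige G" and s: "s \<in> {1, -1}"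
  shows "card {a \<in> carrier G. sign_on (carrier G) (\<lambda>x. a \<otimes> x) = s} = order G div 2"
proof -
  let ?\<chi> = "\<lambda>a. sign_on (carrier G) (\<lambda>x. a \<otimes> x)"
  let ?A = "\<lambda>s. {a \<in> carrier G. ?\<chi> a = s}"
  obtain c where c: "c \<in> carrier G" "?\<chi> c = -1"
    using assms ex_odd_translation_iff_not_hall_paige by blast
  have shift: "(\<lambda>x. c \<otimes> x) ` ?A s \<subseteq> ?A (- s)" for s
    using c fin by (auto simp: sign_on_mult_left_mult simp del: sign_on_cong)
  have inj: "inj_on (\<lambda>x. c \<otimes> x) (?A s)" for s
    using bij_betw_imp_inj_on[OF bij_betw_mult_left[OF c(1)]] by (rule inj_on_subset) auto
  have "card (?A s) \<le> card (?A (- s))" for s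
    using fin by (intro card_inj_on_le[OF inj shift]) simp
  from this[of 1] this[of "-1"] have eq: "card (?A 1) = card (?A (-1))"
    by simp
  have "carrier G = ?A 1 \<union> ?A (-1)"
    by (auto simp: sign_on_def sign_def)
  then have "order G = card (?A 1 \<union> ?A (-1))"
    unfolding order_def by simp
  also have "\<dots> = card (?A 1) + card (?A (-1))"
    using fin by (intro card_Un_disjoint) auto
  finally show ?thesis
    using eq s by auto
qed

text \<open>
  The rows use this with \<open>s = 1\<close>. The columns use it with \<open>s\<close> the sign of \<open>h\<close>: a column
  permutation is even iff the sign of its translation equals that of \<open>h\<close>.
\<close>

lemma min_card_parity_translations:
  assumes fin: "finite (carrier G)" and f: "bij_betw f I (carrier G)" and s: "s \<in> {1, -1}"
    and Q: "\<And>i. i \<in> I \<Longrightarrow> Q i \<longleftrightarrow> sign_on (carrier G) (\<lambda>x. f i \<otimes> x) = s"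
  shows "min (card {i \<in> I. Q i}) (card {i \<in> I. \<not> Q i}) = (if hall_paige G then 0 else order G div 2)"
proof -
  let ?\<chi> = "\<lambda>a. sign_on (carrier G) (\<lambda>x. a \<otimes> x)"
  have card_eq: "card {i \<in> I. R (f i)} = card {a \<in> carrier G. R a}" for R
  proof (rule bij_betw_same_card)
    show "bij_betw f {i \<in> I. R (f i)} {a \<in> carrier G. R a}"
      using f by (auto simp: bij_betw_def intro: inj_on_subset)
  qed
  have "{i \<in> I. Q i} = {i \<in> I. ?\<chi> (f i) = s}"
    using Q by auto
  then have even: "card {i \<in> I. Q i} = card {a \<in> carrier G. ?\<chi> a = s}"
    using card_eq[of "\<lambda>a. ?\<chi> a = s"] by simp
  have "?\<chi> a \<noteq> s \<longleftrightarrow> ?\<chi> a = - s" for a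
    using s by (auto simp: sign_on_def sign_def)
  then have "{i \<in> I. \<not> Q i} = {i \<in> I. ?\<chi> (f i) = - s}"
    using Q by auto
  then have odd: "card {i \<in> I. \<not> Q i} = card {a \<in> carrier G. ?\<chi> a = - s}"
    using card_eq[of "\<lambda>a. ?\<chi> a = - s"] by simp
  show ?thesis
  proof (cases "hall_paige G")
    case True
    then have "{a \<in> carrier G. ?\<chi> a = -1} = {}"
      using ex_odd_translation_iff_not_hall_paige[OF fin] by blast
    then have none: "card {a \<in> carrier G. ?\<chi> a = -1} = 0"
      by (metis card.empty)
    from s consider "s = 1" | "s = -1" by auto
    then show ?thesis
      by cases (simp_all only: even odd none True if_True minus_minus min_0L min_0R)
  next
    case False
    moreover have "- s \<in> {1, -1}"
      using s by auto
    ultimately show ?thesis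
      using s by (simp only: even odd card_translations_of_sign[OF fin False] min.idem if_False)
  qed
qed

end


section \<open>The parity type\<close>

theorem corollary5p2p9:
  fixes G :: "('a, 'b) monoid_scheme" and g :: "nat \<Rightarrow> 'a" and h :: "'a \<Rightarrow> 'a"
  assumes "group G" and "finite (carrier G)"
    and "bij_betw g {1..order G} (carrier G)"
    and "h permutes carrier G"
  shows "kotlar_parity_type (carrier G) g (group_latin_square G g h) =
    (if hall_paige G then (0, 0) else (order G div 2, order G div 2))"
proof -
  interpret group G by fact
  note fin = assms(2) and g = assms(3) and h = assms(4)
  let ?X = "carrier G" and ?L = "group_latin_square G g h"
  let ?I = "{1..order G}" and ?\<chi> = "\<lambda>a. sign_on (carrier G) (\<lambda>x. a \<otimes>\<^bsub>G\<^esub> x)"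
  have gc: "g i \<in> ?X" if "i \<in> ?I" for i
    using bij_betwE[OF g] that by blast
  have g': "g (inv_into ?I g y) = y" if "y \<in> ?X" for y
    using bij_betw_inv_into_right[OF g that] .
  have h': "bij_betw h ?X ?X"
    using h by (rule permutes_imp_bij)
  have hg: "bij_betw (\<lambda>i. h (g i)) ?I ?X"
    using bij_betw_trans[OF g h'] by (simp add: comp_def)
  have row: "evenperm (row_perm ?X g ?L i) \<longleftrightarrow> ?\<chi> (h (g i)) = 1" if "i \<in> ?I" for i
  proof -
    have "row_perm ?X g ?L i = restrict_id (\<lambda>x. h (g i) \<otimes>\<^bsub>G\<^esub> x) ?X"
      using g' by (auto simp: row_perm_def restrict_id_def group_latin_square_def order_def fun_eq_iff)
    then show ?thesis
      by (simp add: sign_on_def sign_def)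
  qed
  have column: "evenperm (column_perm ?X g ?L j) \<longleftrightarrow> ?\<chi> (g j) = sign_on ?X h" if "j \<in> ?I" for j
  proof -
    have "column_perm ?X g ?L j = restrict_id ((\<lambda>x. x \<otimes>\<^bsub>G\<^esub> g j) \<circ> h) ?X"
      using g' by (auto simp: column_perm_def restrict_id_def group_latin_square_def order_def fun_eq_iff)
    then have "evenperm (column_perm ?X g ?L j) \<longleftrightarrow> sign_on ?X ((\<lambda>x. x \<otimes>\<^bsub>G\<^esub> g j) \<circ> h) = 1"
      by (simp add: sign_on_def sign_def)
    also have "sign_on ?X ((\<lambda>x. x \<otimes>\<^bsub>G\<^esub> g j) \<circ> h) = sign_on ?X (\<lambda>x. x \<otimes>\<^bsub>G\<^esub> g j) * sign_on ?X h"
      by (rule sign_on_compose[OF _ h' fin])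
        (rule bij_betw_byWitness[where f' = "\<lambda>x. x \<otimes>\<^bsub>G\<^esub> inv\<^bsub>G\<^esub> g j"],
          use gc[OF that] in \<open>auto simp: m_assoc\<close>)
    also have "sign_on ?X (\<lambda>x. x \<otimes>\<^bsub>G\<^esub> g j) = ?\<chi> (g j)"
      by (rule sign_on_mult_right[OF fin gc[OF that]])
    also have "?\<chi> (g j) * sign_on ?X h = 1 \<longleftrightarrow> ?\<chi> (g j) = sign_on ?X h"
      by (simp add: sign_on_def sign_def)
    finally show ?thesis .
  qed
  have sign_h: "sign_on ?X h \<in> {1, -1}"
    by (simp add: sign_on_def sign_def)
  have one: "(1::int) \<in> {1, -1}"
    by simp
  show ?thesis
    using min_card_parity_translations[OF fin hg one row]
      min_card_parity_translations[OF fin g sign_h column]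
    by (simp only: kotlar_parity_type_def flip: order_def) simp
qed

end
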